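(* Let $r\in C^\infty(J)$ be an admissible function. The Weingarten operator $A$, with respect to $N$, of the Lorentzian hypersurface $Q(r)\subset\mathbb{L}^{n+2}$ is given by $$A(V)=\alpha(t)\,V+\beta(t)\,\langle T(t,x),V\rangle\,T(t,x)$$ for all $(t,x)\in Q(r)$ and all $V\in T_{(t,x)}Q(r)$, where $$\alpha(t)=\frac{-1}{r(t)\sqrt{1-r'(t)^2}},\qquad \beta(t)=\frac{r''(t)r(t)+r'(t)^2-1}{r(t)(1-r'(t)^2)^{3/2}}.$$
   Context: $\mathbb{L}^{n+2}$ is $\mathbb{R}^{n+2}$ with coordinates $(t,x)=(t,x_1,\dots,x_{n+1})$ and the Lorentzian metric $\langle\,,\rangle=-dt^2+dx_1^2+\dots+dx_{n+1}^2$. Let $J\subset\mathbb{R}$ be an open interval with $0\in J$. A function $r\in C^\infty(J)$ is called admissible if $r(t)>0$ and $|r'(t)|<1$ for all $t\in J$. For such $r$, $Q(r)=\{(t,x)\in J\times\mathbb{R}^{n+1}: x_1^2+\dots+x_{n+1}^2=r(t)^2\}$, a hypersurface of $\mathbb{L}^{n+2}$ whose induced metric is Lorentzian. Its unit spacelike normal vector field is $N(t,x)=\frac{1}{r(t)\sqrt{1-r'(t)^2}}\big(r'(t)r(t),x\big)$, and $T(t,x)=\frac{1}{\sqrt{1-r'(t)^2}}\big(1,\frac{r'(t)}{r(t)}x\big)$ is a unit timelike tangent vector field on $Q(r)$. The Weingarten operator with respect to $N$ is $A(V)=-\nabla^0_VN$, where $\nabla^0$ is the Levi-Civita connection of $\mathbb{L}^{n+2}$.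 *)

theory Defs
  imports "HOL-Analysis.Analysis"
begin

text \<open>
  The Lorentz-Minkowski space of dimension \<open>n + 2\<close>, with \<open>CARD('m) = n + 1\<close>; a point is \<open>(t, x)\<close>,
  and every tangent space is identified with the same vector space.
\<close>

type_synonym 'm minkowski = "real \<times> (real ^ 'm)"

definition lorentz :: "('m::finite) minkowski \<Rightarrow> 'm minkowski \<Rightarrow> real"
  where "lorentz u v = - (fst u * fst v) + (\<Sum>i\<in>UNIV. snd u $ i * snd v $ i)"

text \<open>
  Meant for open \<open>S\<close>, where it says that derivatives of all orders exist at every point of \<open>S\<close>.
  For real-valued \<open>f\<close>, \<open>vector_derivative f (at s)\<close> is \<open>deriv f s\<close>.
\<close>

definition smooth_on :: "real set \<Rightarrow> (real \<Rightarrow> 'a::real_normed_vector) \<Rightarrow> bool"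
  where "smooth_on S f \<longleftrightarrow>
    (\<forall>k. \<forall>s\<in>S. ((\<lambda>g s. vector_derivative g (at s)) ^^ k) f differentiable (at s))"

lemma vector_derivative_eq_deriv: "vector_derivative f (at s) = deriv f s"
  by (simp add: vector_derivative_def deriv_def has_real_derivative_iff_has_vector_derivative)

definition admissible :: "real set \<Rightarrow> (real \<Rightarrow> real) \<Rightarrow> bool"
  where "admissible J r \<longleftrightarrow> smooth_on J r \<and> (\<forall>t\<in>J. r t > 0 \<and> \<bar>deriv r t\<bar> < 1)"

definition Q :: "real set \<Rightarrow> (real \<Rightarrow> real) \<Rightarrow> ('m::finite) minkowski set"
  where "Q J r = {(t, x). t \<in> J \<and> (\<Sum>i\<in>UNIV. (x $ i)\<^sup>2) = (r t)\<^sup>2}"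

text \<open>Tangent vectors as velocities of smooth curves in \<open>M\<close> through \<open>p\<close>.\<close>

definition tangent_space :: "'a::real_normed_vector set \<Rightarrow> 'a \<Rightarrow> 'a set"
  where "tangent_space M p = {V. \<exists>c e. e > 0 \<and> smooth_on {-e<..<e} c \<and> c ` {-e<..<e} \<subseteq> M \<and>
    c 0 = p \<and> (c has_vector_derivative V) (at 0)}"

text \<open>
  Since the coefficients of the metric in the global coordinates are constant, its Christoffel
  symbols vanish, and the Levi-Civita connection is the componentwise directional derivative:
  \<open>nabla0 V X p\<close> is the covariant derivative at \<open>p\<close>, in the direction \<open>V\<close>, of a vector field \<open>X\<close>
  differentiable near \<open>p\<close>.
\<close>

definition nabla0 ::
    "('m::finite) minkowski \<Rightarrow> ('m minkowski \<Rightarrow> 'm minkowski) \<Rightarrow> 'm minkowski \<Rightarrow> 'm minkowski"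
  where "nabla0 V X p = frechet_derivative X (at p) V"

text \<open>
  The field \<open>N\<close> is given on a neighbourhood of the hypersurface \<open>M\<close>; for \<open>V\<close> tangent to \<open>M\<close> only
  its values on \<open>M\<close> matter (see \<open>nabla0_along_curve\<close> below).
\<close>

definition weingarten ::
    "(('m::finite) minkowski \<Rightarrow> 'm minkowski) \<Rightarrow> 'm minkowski \<Rightarrow> 'm minkowski \<Rightarrow> 'm minkowski"
  where "weingarten N p V = - nabla0 V N p"

text \<open>
  The following formulas make sense on all of \<open>J \<times> UNIV\<close>, which is open and contains \<open>Q J r\<close>.
\<close>

definition normal_field :: "(real \<Rightarrow> real) \<Rightarrow> ('m::finite) minkowski \<Rightarrow> 'm minkowski"
  where "normal_field r = (\<lambda>(t, x).
    (1 / (r t * sqrt (1 - (deriv r t)\<^sup>2))) *\<^sub>R (deriv r t * r t, x))"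

definition timelike_field :: "(real \<Rightarrow> real) \<Rightarrow> ('m::finite) minkowski \<Rightarrow> 'm minkowski"
  where "timelike_field r = (\<lambda>(t, x).
    (1 / sqrt (1 - (deriv r t)\<^sup>2)) *\<^sub>R (1, (deriv r t / r t) *\<^sub>R x))"

lemma nabla0_along_curve:
  assumes "X differentiable (at p)" "c 0 = p" "(c has_vector_derivative V) (at 0)"
  shows "((\<lambda>s. X (c s)) has_vector_derivative nabla0 V X p) (at 0)"
proof -
  have X: "(X has_derivative frechet_derivative X (at p)) (at (c 0))"
    using assms(1,2) by (simp add: frechet_derivative_works)
  have c: "(c has_derivative (\<lambda>h. h *\<^sub>R V)) (at 0)"
    using assms(3) by (simp add: has_vector_derivative_def)
  have "linear (frechet_derivative X (at p))"
    using assms(1) by (rule linear_frechet_derivative)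
  then show ?thesis
    using diff_chain_at[OF c X]
    by (simp add: has_vector_derivative_def nabla0_def o_def linear_scale)
qed

lemma nabla0_metric:
  fixes X Y :: "('m::finite) minkowski \<Rightarrow> 'm minkowski"
  assumes "X differentiable (at p)" "Y differentiable (at p)"
  shows "((\<lambda>q. lorentz (X q) (Y q)) has_derivative
    (\<lambda>V. lorentz (nabla0 V X p) (Y p) + lorentz (X p) (nabla0 V Y p))) (at p)"
proof -
  have X: "(X has_derivative frechet_derivative X (at p)) (at p)"
    and Y: "(Y has_derivative frechet_derivative Y (at p)) (at p)"
    using assms by (simp_all add: frechet_derivative_works)
  have L: "lorentz u v = - (fst u * fst v) + snd u \<bullet> snd v" for u v :: "('m::finite) minkowski"
    by (simp add: lorentz_def inner_vec_def)
  show ?thesis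
    unfolding L nabla0_def
    by (rule derivative_eq_intros has_derivative_fst[OF X] has_derivative_fst[OF Y]
        has_derivative_snd[OF X] has_derivative_snd[OF Y] refl)+ (simp add: algebra_simps)
qed

lemma lorentz_normal_field:
  assumes "admissible J r" "p \<in> Q J r"
  shows "lorentz (normal_field r p) (normal_field r p) = 1"
proof -
  obtain t x where p: "p = (t, x)" by (cases p)
  with assms have t: "r t > 0" "\<bar>deriv r t\<bar> < 1" and x: "(\<Sum>i\<in>UNIV. x $ i * x $ i) = r t * r t"
    by (auto simp: admissible_def Q_def power2_eq_square)
  define w where "w = sqrt (1 - (deriv r t)\<^sup>2)"
  have w: "w > 0" "w * w = 1 - deriv r t * deriv r t"
    using t(2) by (auto simp: w_def abs_square_less_1 power2_eq_square[symmetric] less_imp_le)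
  have N: "normal_field r p = (1 / (r t * w)) *\<^sub>R (deriv r t * r t, x)"
    by (simp add: p normal_field_def w_def)
  have "lorentz (normal_field r p) (normal_field r p)
      = (1 / (r t * w))\<^sup>2 * (- (deriv r t * r t)\<^sup>2 + (\<Sum>i\<in>UNIV. x $ i * x $ i))"
    unfolding N lorentz_def distrib_left sum_distrib_left
    by (simp add: power2_eq_square mult_ac)
  also have "\<dots> = (1 / (r t * w))\<^sup>2 * ((r t)\<^sup>2 * (w * w))"
    unfolding x w(2) by (simp add: power2_eq_square algebra_simps)
  also have "\<dots> = 1"
    using t(1) w(1) by (simp add: power2_eq_square)
  finally show ?thesis .
qed

lemma lorentz_normal_field_tangent:
  assumes "open J" "admissible J r" "p \<in> Q J r" "V \<in> tangent_space (Q J r) p"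
  shows "lorentz (normal_field r p) V = 0"
proof -
  obtain t x where p: "p = (t, x)" by (cases p)
  obtain c e where e: "e > 0" "c ` {-e<..<e} \<subseteq> Q J r" "c 0 = p"
    "(c has_vector_derivative V) (at 0)"
    using assms(4) by (auto simp: tangent_space_def)
  have "t \<in> J" using assms(3) p by (simp add: Q_def)
  then have rt: "r t > 0" and "r differentiable (at t)"
    using assms(2) unfolding admissible_def smooth_on_def by (auto dest: spec[of _ 0])
  then have r: "(r has_derivative (\<lambda>h. h * deriv r t)) (at (fst (c 0)))"
    using e(3) p by (simp add: DERIV_deriv_iff_real_differentiable[symmetric]
        has_field_derivative_def mult_commute_abs)
  have c: "(c has_derivative (\<lambda>h. h *\<^sub>R V)) (at 0)"
    using e(4) by (simp add: has_vector_derivative_def)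
  have rc: "((\<lambda>s. r (fst (c s))) has_derivative (\<lambda>h. h * fst V * deriv r t)) (at 0)"
    using diff_chain_at[OF has_derivative_fst[OF c] r] by (simp add: o_def)
  define f where "f s = snd (c s) \<bullet> snd (c s) - r (fst (c s)) * r (fst (c s))" for s
  have "(f has_derivative
      (\<lambda>h. 2 * h * (snd (c 0) \<bullet> snd V - r (fst (c 0)) * fst V * deriv r t))) (at 0)"
    unfolding f_def
    by (rule derivative_eq_intros has_derivative_snd[OF c] rc refl)+
      (simp add: inner_commute algebra_simps fun_eq_iff)
  moreover have "(f has_derivative (\<lambda>h. 0)) (at 0)"
  proof (rule has_derivative_transform_within_open[OF has_derivative_const[of 0]])
    fix s assume "s \<in> {-e<..<e}"
    then have "c s \<in> Q J r" using e(2) by blast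
    then show "0 = f s"
      by (auto simp: f_def Q_def inner_vec_def power2_eq_square)
  qed (use e(1) in auto)
  ultimately have "(\<lambda>h. 2 * h * (x \<bullet> snd V - r t * fst V * deriv r t)) = (\<lambda>h. 0)"
    using e(3) p by (auto dest: has_derivative_unique)
  from fun_cong[OF this, of 1] have "x \<bullet> snd V = r t * fst V * deriv r t" by simp
  moreover have "lorentz (normal_field r p) V
      = 1 / (r t * sqrt (1 - (deriv r t)\<^sup>2)) * (x \<bullet> snd V - r t * fst V * deriv r t)"
    unfolding p lorentz_def normal_field_def inner_vec_def right_diff_distrib sum_distrib_left
    by (simp add: mult_ac)
  ultimately show ?thesis by simp
qed

end

theory Submission
  imports Defs
begin

text \<open>
  Write \<open>w = sqrt (1 - r'\<^sup>2)\<close>. Differentiating \<open>N = (r' / w, x / (r w))\<close> in the ambient space in the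
  direction \<open>V = (\<tau>, v)\<close> gives \<open>v / (r w)\<close> in the second component, which accounts for \<open>\<alpha> V\<close>, and
  otherwise only multiples of \<open>\<tau>\<close>. Tangency of \<open>V\<close> means \<open>\<langle>x, v\<rangle> = r r' \<tau>\<close>, so
  \<open>\<langle>T, V\<rangle> = - w \<tau>\<close>, and the terms in \<open>\<tau>\<close> combine to a multiple of \<open>\<langle>T, V\<rangle> T\<close>.
\<close>

lemma smooth_on_imp_DERIV:
  fixes r :: "real \<Rightarrow> real"
  assumes "smooth_on J r" "t \<in> J"
  shows "(r has_real_derivative deriv r t) (at t)"
    and "(deriv r has_real_derivative deriv (deriv r) t) (at t)"
proof -
  have "r differentiable (at t)"
    using assms unfolding smooth_on_def by (auto dest: spec[of _ 0])
  then show "(r has_real_derivative deriv r t) (at t)"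
    by (simp add: DERIV_deriv_iff_real_differentiable)
  have "(\<lambda>s. vector_derivative r (at s)) differentiable (at t)"
    using assms unfolding smooth_on_def by (auto dest: spec[of _ 1])
  then show "(deriv r has_real_derivative deriv (deriv r) t) (at t)"
    by (simp add: vector_derivative_eq_deriv DERIV_deriv_iff_real_differentiable)
qed

text \<open>On the ambient space the field has the form \<open>(g t, h t *\<^sub>R x)\<close> with
  scalar functions \<open>g\<close>, \<open>h\<close> of time alone. Linearity in \<open>x\<close>
  yields the \<open>snd V\<close> term; all else is a one-variable derivative times
  \<open>fst V\<close>.\<close>

lemma nabla0_normal_field:
  fixes x :: "real ^ 'm"
  assumes "admissible J r" "t \<in> J"
  defines "w \<equiv> sqrt (1 - (deriv r t)\<^sup>2)"
  shows "nabla0 V (normal_field r) (t, x) =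
    ((deriv (deriv r) t / w ^ 3) * fst V,
     (1 / (r t * w)) *\<^sub>R snd V +
       (fst V * deriv r t * (deriv (deriv r) t * r t - w\<^sup>2) / ((r t)\<^sup>2 * w ^ 3)) *\<^sub>R x)"
proof -
  define a where "a = deriv r t"
  define b where "b = deriv (deriv r) t"
  have rt: "r t > 0" and "\<bar>a\<bar> < 1"
    using assms by (auto simp: admissible_def a_def)
  then have a: "a\<^sup>2 < 1" by (simp add: abs_square_less_1)
  then have w: "w > 0" and w2: "w\<^sup>2 = 1 - a\<^sup>2"
    by (simp_all add: w_def a_def)
  have r: "(r has_real_derivative a) (at t)"
    and r': "(deriv r has_real_derivative b) (at t)"
    using smooth_on_imp_DERIV[of J r t] assms by (simp_all add: admissible_def a_def b_def)
  define u where "u s = r s * sqrt (1 - (deriv r s)\<^sup>2)" for s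
  define h where "h s = 1 / u s" for s
  have ut: "u t = r t * w" by (simp add: u_def w_def)
  \<comment> \<open>This is \<open>- u' / u\<^sup>2\<close> at \<open>t\<close>, where
    \<open>u' = a * w - a * b * r t / w\<close>, put over one denominator.\<close>
  define h' where "h' = a * (b * r t - w\<^sup>2) / ((r t)\<^sup>2 * w ^ 3)"
  \<comment> \<open>The strict bound on \<open>a\<close> keeps the argument of the root away from 0,
    where the root is not differentiable.\<close>
  have W: "((\<lambda>s. sqrt (1 - (deriv r s)\<^sup>2)) has_real_derivative - (a * b / w)) (at t)"
    using a by (auto intro!: derivative_eq_intros r' simp: w_def a_def field_simps)
  have h: "(h has_real_derivative h') (at t)"
  proof -
    have "(u has_real_derivative a * w + - (a * b / w) * r t) (at t)"
      unfolding u_def using DERIV_mult[OF r W] by (simp add: w_def)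
    then have "(h has_real_derivative
        - (a * w + r t * - (a * b / w)) / (r t * w)\<^sup>2) (at t)"
      unfolding h_def using rt w
      by (auto intro!: derivative_eq_intros simp: ut power2_eq_square mult_ac)
    moreover have "- (a * w + r t * - (a * b / w)) / (r t * w)\<^sup>2 = h'"
      using rt w by (simp add: h'_def field_simps power2_eq_square power3_eq_cube)
    ultimately show ?thesis by simp
  qed
  have g: "((\<lambda>s. h s * (deriv r s * r s)) has_real_derivative b / w ^ 3) (at t)"
  proof -
    have "((\<lambda>s. h s * (deriv r s * r s)) has_real_derivative
        h' * (a * r t) + (b * r t + a * a) / (r t * w)) (at t)"
      using DERIV_mult[OF h DERIV_mult[OF r' r]] by (simp add: h_def ut a_def)
    \<comment> \<open>Over the denominator \<open>r t * w ^ 3\<close> the two terms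
      \<open>a\<^sup>2 * w\<^sup>2\<close> cancel; afterwards
      \<open>a\<^sup>2 + w\<^sup>2 = 1\<close>.\<close>
    moreover have "h' * (a * r t) + (b * r t + a * a) / (r t * w) = b * (a\<^sup>2 + w\<^sup>2) / w ^ 3"
      using rt w by (simp add: h'_def field_simps power2_eq_square power3_eq_cube)
    ultimately show ?thesis by (simp add: w2)
  qed
  have along_fst: "((\<lambda>p :: 'm minkowski. f (fst p)) has_derivative (\<lambda>V. f' * fst V)) (at (t, x))"
    if "(f has_real_derivative f') (at t)" for f f'
    using has_derivative_compose[of fst fst "(t, x)" UNIV f "(*) f'"] that
    by (simp add: has_field_derivative_def has_derivative_fst)
  have "(normal_field r has_derivative
      (\<lambda>V. (b / w ^ 3 * fst V, h t *\<^sub>R snd V + (h' * fst V) *\<^sub>R x))) (at (t, x))"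
  proof -
    have "normal_field r = (\<lambda>p :: 'm minkowski.
        (h (fst p) * (deriv r (fst p) * r (fst p)), h (fst p) *\<^sub>R snd p))"
      by (auto simp: normal_field_def h_def u_def)
    moreover have "((\<lambda>p :: 'm minkowski. h (fst p) *\<^sub>R snd p) has_derivative
        (\<lambda>V. h t *\<^sub>R snd V + (h' * fst V) *\<^sub>R x)) (at (t, x))"
      using has_derivative_scaleR[OF along_fst[OF h] has_derivative_snd[OF has_derivative_ident]]
      by simp
    ultimately show ?thesis
      using has_derivative_Pair[OF along_fst[OF g]] by simp
  qed
  from frechet_derivative_at[OF this, symmetric] show ?thesis
    by (simp add: nabla0_def h'_def h_def u_def a_def b_def w_def mult_ac)
qed

text \<open>Orthogonality of \<open>V\<close> to the normal expresses
  \<open>x \<bullet> snd V\<close> through \<open>fst V\<close>. The remaining factor is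
  \<open>a\<^sup>2 - 1 = - w\<^sup>2\<close>, and the normalisation of the timelike field removes
  one \<open>w\<close>.\<close>

lemma lorentz_timelike_field_tangent:
  fixes x :: "real ^ 'm"
  assumes "open J" "admissible J r" "(t, x) \<in> Q J r" "V \<in> tangent_space (Q J r) (t, x)"
  shows "lorentz (timelike_field r (t, x)) V = - sqrt (1 - (deriv r t)\<^sup>2) * fst V"
proof -
  define a where "a = deriv r t"
  define w where "w = sqrt (1 - a\<^sup>2)"
  have rt: "r t > 0" and "\<bar>a\<bar> < 1"
    using assms by (auto simp: admissible_def a_def Q_def)
  then have w: "w > 0" "w\<^sup>2 = 1 - a\<^sup>2"
    by (simp_all add: w_def abs_square_less_1 less_imp_le)
  have L: "lorentz u v = - (fst u * fst v) + snd u \<bullet> snd v" for u v :: "'m minkowski"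
    by (simp add: lorentz_def inner_vec_def)
  have "lorentz (normal_field r (t, x)) V = 0"
    using assms by (rule lorentz_normal_field_tangent)
  then have xv: "x \<bullet> snd V = a * r t * fst V"
    using rt w(1) by (simp add: L normal_field_def a_def[symmetric] w_def[symmetric] field_simps)
  have "lorentz (timelike_field r (t, x)) V = (- fst V + a / r t * (x \<bullet> snd V)) / w"
    by (simp add: L timelike_field_def a_def[symmetric] w_def[symmetric] diff_divide_distrib)
  also have "\<dots> = - (1 - a\<^sup>2) * fst V / w"
    using rt by (simp add: xv power2_eq_square algebra_simps)
  also have "\<dots> = - w * fst V"
    unfolding w(2)[symmetric] using w(1) by (simp add: power2_eq_square)
  finally show ?thesis by (simp add: w_def a_def)
qed

theorem lemma3p1:
  fixes J :: "real set" and r :: "real \<Rightarrow> real"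
  assumes "open J" and "is_interval J" and "0 \<in> J" and "admissible J r"
  shows "\<forall>(t, x :: real ^ 'm) \<in> Q J r. \<forall>V \<in> tangent_space (Q J r) (t, x).
    (let \<alpha> = - 1 / (r t * sqrt (1 - (deriv r t)\<^sup>2));
         \<beta> = (deriv (deriv r) t * r t + (deriv r t)\<^sup>2 - 1) / (r t * (1 - (deriv r t)\<^sup>2) powr (3 / 2));
         T = timelike_field r (t, x)
     in weingarten (normal_field r) (t, x) V = \<alpha> *\<^sub>R V + (\<beta> * lorentz T V) *\<^sub>R T)"
proof -
  have "weingarten (normal_field r) (t, x) V =
      (- 1 / (r t * sqrt (1 - (deriv r t)\<^sup>2))) *\<^sub>R V +
      ((deriv (deriv r) t * r t + (deriv r t)\<^sup>2 - 1) / (r t * (1 - (deriv r t)\<^sup>2) powr (3 / 2)) *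
        lorentz (timelike_field r (t, x)) V) *\<^sub>R timelike_field r (t, x)"
    if p: "(t, x) \<in> Q J r" and V: "V \<in> tangent_space (Q J r) (t, x)" for t V and x :: "real ^ 'm"
  proof -
    define a where "a = deriv r t"
    define b where "b = deriv (deriv r) t"
    define w where "w = sqrt (1 - a\<^sup>2)"
    have t: "t \<in> J" using p by (simp add: Q_def)
    then have rt: "r t > 0" and "\<bar>a\<bar> < 1"
      using assms(4) by (auto simp: admissible_def a_def)
    then have a: "1 - a\<^sup>2 > 0" by (simp add: abs_square_less_1)
    then have w: "w > 0" and w2: "w\<^sup>2 = 1 - a\<^sup>2" by (simp_all add: w_def)
    \<comment> \<open>Turns the real exponent in \<beta> into the integer power of \<open>w\<close>
      produced by differentiation.\<close>
    have powr: "(1 - a\<^sup>2) powr (3 / 2) = w ^ 3"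
    proof -
      have "(w powr 2) powr (3 / 2) = w powr 3" by (simp add: powr_powr)
      then show ?thesis using w by (simp add: w2)
    qed
    have num: "b * r t + a\<^sup>2 - 1 = b * r t - w\<^sup>2" by (simp add: w2)
    have T: "timelike_field r (t, x) = (1 / w) *\<^sub>R (1, (a / r t) *\<^sub>R x)"
      by (simp add: timelike_field_def a_def w_def)
    have TV: "lorentz (timelike_field r (t, x)) V = - w * fst V"
      unfolding w_def a_def using assms(1,4) p V by (rule lorentz_timelike_field_tangent)
    have A: "weingarten (normal_field r) (t, x) V =
      - ((b / w ^ 3) * fst V,
        (1 / (r t * w)) *\<^sub>R snd V + (fst V * a * (b * r t - w\<^sup>2) / ((r t)\<^sup>2 * w ^ 3)) *\<^sub>R x)"
      unfolding weingarten_def nabla0_normal_field[OF assms(4) t] by (simp add: a_def b_def w_def)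
    \<comment> \<open>Time component: the \<alpha> term equals
      \<open>- w\<^sup>2 * fst V / (r t * w ^ 3)\<close> and cancels the \<open>w\<^sup>2\<close>
      part of the \<beta> term.\<close>
    have tau: "- (b / w ^ 3 * fst V) =
        - 1 / (r t * w) * fst V + (b * r t - w\<^sup>2) / (r t * w ^ 3) * (- w * fst V) * (1 / w)"
      using rt w by (simp add: field_simps power2_eq_square power3_eq_cube)
    \<comment> \<open>Space component: \<alpha> already accounts for \<open>snd V\<close>, so only
      the coefficients of \<open>x\<close> have to agree.\<close>
    have "(b * r t - w\<^sup>2) / (r t * w ^ 3) * (- w * fst V) * (1 / w) * (a / r t) =
        - (fst V * a * (b * r t - w\<^sup>2) / ((r t)\<^sup>2 * w ^ 3))"
      using rt w by (simp add: field_simps power2_eq_square power3_eq_cube)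
    then have "- ((1 / (r t * w)) *\<^sub>R snd V +
          (fst V * a * (b * r t - w\<^sup>2) / ((r t)\<^sup>2 * w ^ 3)) *\<^sub>R x) =
        (- 1 / (r t * w)) *\<^sub>R snd V +
          ((b * r t - w\<^sup>2) / (r t * w ^ 3) * (- w * fst V) * (1 / w) * (a / r t)) *\<^sub>R x"
      by (simp only: scaleR_minus_left minus_add_distrib minus_divide_left[symmetric])
    then have "weingarten (normal_field r) (t, x) V =
        (- 1 / (r t * w)) *\<^sub>R V +
        ((b * r t - w\<^sup>2) / (r t * w ^ 3) * (- w * fst V)) *\<^sub>R (1 / w) *\<^sub>R (1, (a / r t) *\<^sub>R x)"
      unfolding A using tau
      by (simp only: prod_eq_iff fst_uminus snd_uminus fst_add snd_add fst_scaleR snd_scaleR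
          fst_conv snd_conv scaleR_scaleR real_scaleR_def mult_1_right simp_thms mult.assoc)
    then show ?thesis
      \<comment> \<open>\<open>TV\<close> goes first, because \<open>T\<close> would rewrite the
        field inside \<open>lorentz\<close> and hide the left-hand side of
        \<open>TV\<close>.\<close>
      unfolding TV unfolding T a_def[symmetric] b_def[symmetric] w_def[symmetric] powr num .
  qed
  then show ?thesis unfolding Let_def by blast
qed

end
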